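(* Assume that for any $\mathbf u^{rel}\in\mathcal U$ there exists a neighborhood $S_{\mathcal N}(\mathbf u^{rel})$ of $\mathbf u^{rel}$ such that $$S_{\mathcal N}(\mathbf u^{rel})\subseteq\Big\{\mathbf u^*:\kappa_0=\arg\min_{\kappa}\min_{\boldsymbol\xi}L\big(G_z(\kappa_0,\boldsymbol\xi_0,\mathbf u^{rel}),G_z(\kappa,\boldsymbol\xi,\mathbf u^* )\big)\Big\},$$ and $\mathbb P_{(\mathbf U^*,\mathbf U)}\{\mathbf U^*\in S_{\mathcal N}(\mathbf U)\}\ge P_{\mathcal N}>0$ for a positive number $P_{\mathcal N}$, where $\mathbf U^*$ is an independent copy of $\mathbf U$. Let $\mathcal V_c$ be a collection of independent Monte-Carlo copies of $\mathbf U$, independent of $\mathbf U$, and $$\widehat\Upsilon_{\mathcal V_c}(\mathbf z)=\Big\{\kappa^*=\arg\min_{\kappa}\min_{\boldsymbol\xi}L\big(\mathbf z,G_z(\kappa,\boldsymbol\xi,\mathbf u^c)\big)\ \Big|\ \mathbf u^c\in\mathcal V_c\Big\}.$$ Then there exists a positive number $c$ such that, in probability (with respect to the Monte-Carlo randomness of $\mathcal V_c$, as $|\mathcal V_c|\to\infty$), (a) $\mathbb P_{\mathbf U|\mathcal V_c}\{\kappa_0\in\widehat\Upsilon_{\mathcal V_c}(\mathbf Z)\}=1-o_p(e^{-c|\mathcal V_c|})$, and (b) $\mathbb P_{\mathbf U|\mathcal V_c}\{\boldsymbol\theta_0\in\Gamma'_\alpha(\mathbf Z)\}\ge\alpha-o_p(e^{-c|\mathcal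 V_c|})$, where $\Gamma'_\alpha(\mathbf z)=\{\boldsymbol\theta=(\kappa,\boldsymbol\xi^\top)^\top\in\Theta:\kappa\in\widehat\Upsilon_{\mathcal V_c}(\mathbf z),\ \exists\,\mathbf u^*\in\mathcal U\text{ such that }\mathbf z=G_z(\kappa,\boldsymbol\xi,\mathbf u^* ),\ T(\mathbf u^*,\boldsymbol\theta)\in B_\alpha(\boldsymbol\theta)\}$.
   Context: The data model is $\mathbf Z=G_z(\kappa_0,\boldsymbol\xi_0,\mathbf U)$ with known mapping $G_z$, where $\kappa_0$ is the true value of a discrete parameter $\kappa$ with (countable) parameter space $\Upsilon$, $\boldsymbol\xi_0$ is the true value of the other (nuisance) parameters, $\boldsymbol\theta=(\kappa,\boldsymbol\xi^\top)^\top\in\Theta$, $\boldsymbol\theta_0=(\kappa_0,\boldsymbol\xi_0^\top)^\top$, and $\mathbf U$ is a random vector in $\mathcal U$ with known distribution. The data sample size is fixed. $L(\mathbf z,\mathbf z')$ is a continuous loss function measuring the difference between two copies of data. $T:\mathcal U\times\Theta\to\mathbb R^q$ is a given function and $B_\alpha(\boldsymbol\theta)$, $0<\alpha<1$, are Borel sets with $\mathbb P\{T(\mathbf U,\boldsymbol\theta)\in B_\alpha(\boldsymbol\theta)\}\ge\alpha$ for all $\boldsymbol\theta\in\Theta$. $\mathbb P_{\mathbf U|\mathcal V_c}$ is the conditional distribution of $\mathbf U$ given $\mathcal V_c$. $o_p(e^{-c|\mathcal V_c|})$ is a random quantity $R$ (a function of $\mathcal V_c$) such that $R/e^{-c|\mathcal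 V_c|}\to0$ in probability as $|\mathcal V_c|\to\infty$.
   Formalization: The bound P{U* ∈ S_N(U)} ≥ P_N is assumed conditionally on U, for almost every value u of U: P{U* ∈ S_N(u)} ≥ P_N. With only the joint bound the exponential rate fails (e.g. Cauchy U, location shifts κ ∈ {0, 1, −1}). *)

theory Defs
  imports "HOL-Probability.Probability"
begin

text \<open>
  The inner minimum over the nuisance parameter is the infimum over the \<open>\<kappa>\<close>-section of the
  parameter space \<open>\<Theta>\<close>.  It equals the minimum whenever the minimum is attained; the value is
  taken in the extended reals because \<open>L\<close> is not assumed to be bounded below.
\<close>

definition profile_loss ::
  "('k \<times> 'x) set \<Rightarrow> ('z \<Rightarrow> 'z \<Rightarrow> real) \<Rightarrow> ('k \<Rightarrow> 'x \<Rightarrow> 'u \<Rightarrow> 'z) \<Rightarrow> 'z \<Rightarrow> 'u \<Rightarrow> 'k \<Rightarrow> ereal" where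
  "profile_loss \<Theta> L G z u \<kappa> = (INF \<xi>\<in>{\<xi>. (\<kappa>, \<xi>) \<in> \<Theta>}. ereal (L z (G \<kappa> \<xi> u)))"

text \<open>
  Minimisers over \<open>\<kappa>\<close> need not be unique, so the argmin is the set of all of them, and an
  equation \<open>\<kappa> = argmin\<close> is rendered as membership in that set throughout.
\<close>

definition argmin_kappa ::
  "'k set \<Rightarrow> ('k \<times> 'x) set \<Rightarrow> ('z \<Rightarrow> 'z \<Rightarrow> real) \<Rightarrow> ('k \<Rightarrow> 'x \<Rightarrow> 'u \<Rightarrow> 'z) \<Rightarrow> 'z \<Rightarrow> 'u \<Rightarrow> 'k set" where
  "argmin_kappa \<Upsilon> \<Theta> L G z u = {\<kappa>. is_arg_min (profile_loss \<Theta> L G z u) (\<lambda>\<kappa>. \<kappa> \<in> \<Upsilon>) \<kappa>}"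

definition candidate_set ::
  "'k set \<Rightarrow> ('k \<times> 'x) set \<Rightarrow> ('z \<Rightarrow> 'z \<Rightarrow> real) \<Rightarrow> ('k \<Rightarrow> 'x \<Rightarrow> 'u \<Rightarrow> 'z) \<Rightarrow> 'u set \<Rightarrow> 'z \<Rightarrow> 'k set" where
  "candidate_set \<Upsilon> \<Theta> L G Vc z = (\<Union>u\<in>Vc. argmin_kappa \<Upsilon> \<Theta> L G z u)"

definition conf_set ::
  "'k set \<Rightarrow> ('k \<times> 'x) set \<Rightarrow> ('z \<Rightarrow> 'z \<Rightarrow> real) \<Rightarrow> ('k \<Rightarrow> 'x \<Rightarrow> 'u \<Rightarrow> 'z) \<Rightarrow> 'u set \<Rightarrow>
   ('u \<Rightarrow> 'k \<times> 'x \<Rightarrow> 'q) \<Rightarrow> ('k \<times> 'x \<Rightarrow> 'q set) \<Rightarrow> 'u set \<Rightarrow> 'z \<Rightarrow> ('k \<times> 'x) set" where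
  "conf_set \<Upsilon> \<Theta> L G \<U> T B Vc z =
     {(\<kappa>, \<xi>). (\<kappa>, \<xi>) \<in> \<Theta> \<and> \<kappa> \<in> candidate_set \<Upsilon> \<Theta> L G Vc z \<and>
             (\<exists>u\<in>\<U>. z = G \<kappa> \<xi> u \<and> T u (\<kappa>, \<xi>) \<in> B (\<kappa>, \<xi>))}"

definition mc_sigma :: "'w measure \<Rightarrow> 'u measure \<Rightarrow> (nat \<Rightarrow> 'w \<Rightarrow> 'u) \<Rightarrow> nat \<Rightarrow> 'w measure" where
  "mc_sigma M N V n =
     vimage_algebra (space M) (\<lambda>\<omega>. \<lambda>i\<in>{..<n}. V i \<omega>) (PiM {..<n} (\<lambda>_. N))"

definition cond_probability :: "'w measure \<Rightarrow> 'w measure \<Rightarrow> 'w set \<Rightarrow> 'w \<Rightarrow> real" where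
  "cond_probability M F A = real_cond_exp M F (indicator A)"

text \<open>
  \<open>R n = o\<^sub>p(a n)\<close> as \<open>n \<rightarrow> \<infinity>\<close>, where in addition \<open>R n\<close> is a function of the information \<open>F n\<close>.
\<close>

definition small_o_prob ::
  "'w measure \<Rightarrow> (nat \<Rightarrow> 'w measure) \<Rightarrow> (nat \<Rightarrow> real) \<Rightarrow> (nat \<Rightarrow> 'w \<Rightarrow> real) \<Rightarrow> bool" where
  "small_o_prob M F a R \<longleftrightarrow>
     (\<forall>n. R n \<in> borel_measurable (F n)) \<and>
     (\<forall>\<epsilon>>0. (\<lambda>n. measure M {\<omega> \<in> space M. \<bar>R n \<omega> / a n\<bar> > \<epsilon>}) \<longlonglongrightarrow> 0)"

end

theory Submission
  imports Defs
begin

text \<open>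
  Almost surely in \<open>U\<close>, a Monte-Carlo copy misses \<open>S U\<close> with conditional probability at most
  \<open>1 - P_N \<le> exp (- P_N)\<close>, so all \<open>n\<close> copies miss it with probability at most
  \<open>exp (- P_N * n)\<close>.  On the complementary event \<open>\<kappa>0\<close> is a candidate, so the remainder \<open>R n\<close>, the
  conditional probability that \<open>\<kappa>0\<close> is not a candidate, has expectation at most \<open>exp (- P_N * n)\<close>,
  and Markov's inequality gives (a) for \<open>c = P_N / 2\<close>.  For (b), if \<open>\<kappa>0\<close> is a candidate and
  \<open>T (U, \<theta>\<^sub>0) \<in> B \<theta>\<^sub>0\<close>, then \<open>u\<^sup>* = U\<close> witnesses that \<open>\<theta>\<^sub>0\<close> is in the confidence set; the
  second event is independent of the copies, so the same remainder works.
\<close>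

section \<open>Joint law of the variable and its independent copies\<close>

text \<open>
  Independence is stated through the joint distribution because \<open>indep_var\<close> only relates random
  variables with values in the same type.
\<close>

lemma (in prob_space) distr_head_tail_eq:
  assumes "indep_vars (\<lambda>_. N) (case_nat X Y) UNIV"
  shows "distr M N X \<Otimes>\<^sub>M distr M (PiM {..<n} (\<lambda>_. N)) (\<lambda>\<omega>. \<lambda>i\<in>{..<n}. Y i \<omega>) =
    distr M (N \<Otimes>\<^sub>M PiM {..<n} (\<lambda>_. N)) (\<lambda>\<omega>. (X \<omega>, \<lambda>i\<in>{..<n}. Y i \<omega>))"
proof -
  let ?P = "PiM {0} (\<lambda>_. N)" and ?Q = "PiM (Suc ` {..<n}) (\<lambda>_. N)" and ?R = "PiM {..<n} (\<lambda>_. N)"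
  let ?f = "\<lambda>\<omega>. \<lambda>i\<in>{0}. case_nat X Y i \<omega>" and ?g = "\<lambda>\<omega>. \<lambda>i\<in>Suc ` {..<n}. case_nat X Y i \<omega>"
  let ?h = "\<lambda>f. \<lambda>i\<in>{..<n}. f (Suc i)"
  \<comment> \<open>Restricting the one sequence to the blocks \<open>{0}\<close> and
    \<open>{1..n}\<close> gives two variables of the same function type, so \<open>indep_var\<close>
    applies. Evaluation at 0 and the shift \<open>?h\<close> then push the product law forward to
    \<open>X\<close> and the vector of the \<open>Y i\<close>.\<close>
  have "indep_var ?P ?f ?Q ?g"
    by (rule indep_var_restrict[OF assms]) auto
  then have f: "?f \<in> measurable M ?P" and g: "?g \<in> measurable M ?Q"
    and joint: "distr M ?P ?f \<Otimes>\<^sub>M distr M ?Q ?g = distr M (?P \<Otimes>\<^sub>M ?Q) (\<lambda>\<omega>. (?f \<omega>, ?g \<omega>))"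
    unfolding indep_var_distribution_eq by blast+
  have e: "(\<lambda>f. f 0) \<in> measurable ?P N"
    by (rule measurable_component_singleton) simp
  have h: "?h \<in> measurable ?Q ?R"
    by (intro measurable_restrict measurable_component_singleton) auto
  have X: "distr M N X = distr (distr M ?P ?f) N (\<lambda>f. f 0)"
    by (subst distr_distr[OF e f]) (simp add: comp_def)
  have hg: "?h \<circ> ?g = (\<lambda>\<omega>. \<lambda>i\<in>{..<n}. Y i \<omega>)"
    by (auto simp: fun_eq_iff restrict_def)
  have Y: "distr M ?R (\<lambda>\<omega>. \<lambda>i\<in>{..<n}. Y i \<omega>) = distr (distr M ?Q ?g) ?R ?h"
    by (subst distr_distr[OF h g]) (simp only: hg)
  interpret Y: prob_space "distr (distr M ?Q ?g) ?R ?h"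
    using g h by (intro prob_space.prob_space_distr prob_space_distr) simp_all
  have "distr M N X \<Otimes>\<^sub>M distr M ?R (\<lambda>\<omega>. \<lambda>i\<in>{..<n}. Y i \<omega>) =
      distr (distr M ?P ?f \<Otimes>\<^sub>M distr M ?Q ?g) (N \<Otimes>\<^sub>M ?R) (\<lambda>(x, y). (x 0, ?h y))"
    unfolding X Y using e h by (intro pair_measure_distr) (simp_all add: Y.sigma_finite_measure_axioms)
  also have "\<dots> = distr M (N \<Otimes>\<^sub>M ?R) ((\<lambda>(x, y). (x 0, ?h y)) \<circ> (\<lambda>\<omega>. (?f \<omega>, ?g \<omega>)))"
    unfolding joint
  proof (rule distr_distr)
    show "(\<lambda>\<omega>. (?f \<omega>, ?g \<omega>)) \<in> measurable M (?P \<Otimes>\<^sub>M ?Q)"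
      using f g by (rule measurable_Pair)
    show "(\<lambda>(x, y). (x 0, ?h y)) \<in> measurable (?P \<Otimes>\<^sub>M ?Q) (N \<Otimes>\<^sub>M ?R)"
      unfolding case_prod_beta
      by (intro measurable_Pair measurable_compose[OF measurable_fst e] measurable_compose[OF measurable_snd h])
  qed
  also have "(\<lambda>(x, y). (x 0, ?h y)) \<circ> (\<lambda>\<omega>. (?f \<omega>, ?g \<omega>)) = (\<lambda>\<omega>. (X \<omega>, \<lambda>i\<in>{..<n}. Y i \<omega>))"
    using hg by (simp add: fun_eq_iff)
  finally show ?thesis .
qed

lemma (in prob_space) indep_vars_tail:
  assumes "indep_vars (\<lambda>_. N) (case_nat X Y) UNIV"
  shows "indep_vars (\<lambda>_. N) Y UNIV"
proof -
  let ?G = "\<lambda>X i. {X i -` A \<inter> space M |A. A \<in> sets N}"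
  have rv: "Y i \<in> measurable M N" for i
  proof -
    have "case_nat X Y (Suc i) \<in> measurable M N"
      using assms unfolding indep_vars_def2 by blast
    then show ?thesis by simp
  qed
  have ind: "indep_sets (?G (case_nat X Y)) UNIV"
    using assms unfolding indep_vars_def2 by blast
  have "indep_sets (?G Y) UNIV"
  proof (rule indep_setsI)
    show "?G Y i \<subseteq> events" for i
      using rv by (auto intro: measurable_sets)
  next
    fix A :: "nat \<Rightarrow> 'a set" and J :: "nat set"
    assume J: "J \<noteq> {}" "finite J" and A: "\<forall>j\<in>J. A j \<in> ?G Y j"
    \<comment> \<open>Undoes the shift: the product formula for the whole sequence over the image of
      \<open>J\<close> under \<open>Suc\<close> becomes the one for \<open>Y\<close> over
      \<open>J\<close>.\<close>
    let ?A = "\<lambda>k. A (k - 1)"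
    have "prob (\<Inter>k\<in>Suc ` J. ?A k) = (\<Prod>k\<in>Suc ` J. prob (?A k))"
      by (rule indep_setsD[OF ind]) (use J A in auto)
    then show "prob (\<Inter>j\<in>J. A j) = (\<Prod>j\<in>J. prob (A j))"
      by (simp add: prod.reindex)
  qed
  then show ?thesis
    unfolding indep_vars_def2 using rv by blast
qed

text \<open>By \<open>joint\<close>, Tonelli's theorem writes the probability as an integral over
  the values \<open>x\<close> of \<open>X\<close>. For fixed \<open>x\<close>, independence of the
  \<open>Y i\<close> factors the slice into \<open>card I\<close> probabilities, each at most
  \<open>r\<close> for almost every \<open>x\<close>.\<close>

lemma (in prob_space) prob_indep_all_le_power:
  assumes I: "finite I"
    and X [measurable]: "X \<in> measurable M N" and indep: "indep_vars (\<lambda>_. N) Y I"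
    and joint: "distr M N X \<Otimes>\<^sub>M distr M (PiM I (\<lambda>_. N)) (\<lambda>\<omega>. \<lambda>i\<in>I. Y i \<omega>) =
      distr M (N \<Otimes>\<^sub>M PiM I (\<lambda>_. N)) (\<lambda>\<omega>. (X \<omega>, \<lambda>i\<in>I. Y i \<omega>))"
    and W: "W \<in> sets (N \<Otimes>\<^sub>M N)"
    and r: "0 \<le> r" "AE x in distr M N X. \<forall>i\<in>I. prob {\<omega> \<in> space M. (x, Y i \<omega>) \<in> W} \<le> r"
  shows "prob {\<omega> \<in> space M. \<forall>i\<in>I. (X \<omega>, Y i \<omega>) \<in> W} \<le> r ^ card I"
\<comment> \<open>The product formula and the slice written as an intersection need a nonempty index
  set; for the empty one the bound is \<open>r ^ 0 = 1\<close>.\<close>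
proof (cases "I = {}")
  case True
  then show ?thesis by (simp add: prob_space)
next
  case False
  let ?P = "PiM I (\<lambda>_. N)" and ?Y = "\<lambda>\<omega>. \<lambda>i\<in>I. Y i \<omega>"
  let ?E = "{p \<in> space (N \<Otimes>\<^sub>M ?P). \<forall>i\<in>I. (fst p, snd p i) \<in> W}"
  have Y [measurable]: "?Y \<in> measurable M ?P"
    using indep by (intro measurable_restrict) (auto simp: indep_vars_def)
  have comp: "(\<lambda>p. (fst p, snd p i)) \<in> measurable (N \<Otimes>\<^sub>M ?P) (N \<Otimes>\<^sub>M N)" if "i \<in> I" for i
    using that by measurable
  have E: "?E \<in> sets (N \<Otimes>\<^sub>M ?P)"
  proof (intro sets.sets_Collect_finite_All I)
    fix i assume "i \<in> I"
    have "{p \<in> space (N \<Otimes>\<^sub>M ?P). (fst p, snd p i) \<in> W} =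
        (\<lambda>p. (fst p, snd p i)) -` W \<inter> space (N \<Otimes>\<^sub>M ?P)"
      by auto
    then show "{p \<in> space (N \<Otimes>\<^sub>M ?P). (fst p, snd p i) \<in> W} \<in> sets (N \<Otimes>\<^sub>M ?P)"
      using measurable_sets[OF comp[OF \<open>i \<in> I\<close>] W] by simp
  qed
  interpret D: prob_space "distr M ?P ?Y"
    by (rule prob_space_distr) simp
  interpret DX: prob_space "distr M N X"
    by (rule prob_space_distr) simp
  have slice: "emeasure (distr M ?P ?Y) (Pair x -` ?E) \<le> ennreal (r ^ card I)"
    if x: "x \<in> space N" and le: "\<forall>i\<in>I. prob {\<omega> \<in> space M. (x, Y i \<omega>) \<in> W} \<le> r" for x
  proof -
    have "Pair x -` ?E \<in> sets ?P"
      by (rule sets_Pair1[OF E])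
    then have eq: "emeasure (distr M ?P ?Y) (Pair x -` ?E) = prob (?Y -` (Pair x -` ?E) \<inter> space M)"
      by (simp add: emeasure_distr emeasure_eq_measure)
    have "?Y -` (Pair x -` ?E) \<inter> space M = (\<Inter>i\<in>I. Y i -` (Pair x -` W) \<inter> space M)"
      using False x measurable_space[OF Y] by (auto simp: space_pair_measure)
    then have "prob (?Y -` (Pair x -` ?E) \<inter> space M) = prob (\<Inter>i\<in>I. Y i -` (Pair x -` W) \<inter> space M)"
      by (rule arg_cong)
    also have "\<dots> = (\<Prod>i\<in>I. prob (Y i -` (Pair x -` W) \<inter> space M))"
      using indep_varsD_finite[OF indep False I, of "\<lambda>_. Pair x -` W"] sets_Pair1[OF W] by auto
    also have "\<dots> \<le> (\<Prod>i\<in>I. r)"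
    proof (intro prod_mono conjI)
      fix i assume "i \<in> I"
      have "Y i -` (Pair x -` W) \<inter> space M = {\<omega> \<in> space M. (x, Y i \<omega>) \<in> W}"
        by auto
      then show "prob (Y i -` (Pair x -` W) \<inter> space M) \<le> r"
        using le \<open>i \<in> I\<close> by simp
    qed simp
    finally show ?thesis
      unfolding eq by (intro ennreal_leI) simp
  qed
  have "{\<omega> \<in> space M. \<forall>i\<in>I. (X \<omega>, Y i \<omega>) \<in> W} = (\<lambda>\<omega>. (X \<omega>, ?Y \<omega>)) -` ?E \<inter> space M"
    using measurable_space[OF X] measurable_space[OF Y] by (auto simp: space_pair_measure)
  then have "emeasure M {\<omega> \<in> space M. \<forall>i\<in>I. (X \<omega>, Y i \<omega>) \<in> W} =
      emeasure (distr M N X \<Otimes>\<^sub>M distr M ?P ?Y) ?E"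
    using E by (simp add: joint emeasure_distr)
  also have "\<dots> = (\<integral>\<^sup>+ x. emeasure (distr M ?P ?Y) (Pair x -` ?E) \<partial>distr M N X)"
    by (rule D.emeasure_pair_measure_alt) (use E in \<open>simp cong: sets_pair_measure_cong\<close>)
  also have "\<dots> \<le> (\<integral>\<^sup>+ x. ennreal (r ^ card I) \<partial>distr M N X)"
    by (rule nn_integral_mono_AE, use r(2) AE_space in eventually_elim) (use slice in auto)
  also have "\<dots> = ennreal (r ^ card I)"
    using DX.emeasure_space_1 by simp
  finally show ?thesis
    using r(1) by (simp add: emeasure_eq_measure)
qed

section \<open>Conditional probabilities given an observed variable\<close>

lemma (in prob_space) finite_measure_subalgebra_vimage_algebra:
  assumes "Y \<in> measurable M K"
  shows "finite_measure_subalgebra M (vimage_algebra (space M) Y K)"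
proof
  show "subalgebra M (vimage_algebra (space M) Y K)"
    unfolding subalgebra_def using assms
    by (auto simp: sets_vimage_algebra2 measurable_space intro: measurable_sets)
qed

text \<open>It suffices to integrate over sets \<open>C\<close> of the generated sigma-algebra. Each
  is a preimage under \<open>Y\<close>, so the integral is the mass of a rectangle, which factors
  under the product law.\<close>

lemma (in prob_space) real_cond_exp_indep_event:
  assumes X [measurable]: "X \<in> measurable M N" and Y [measurable]: "Y \<in> measurable M K"
    and joint: "distr M N X \<Otimes>\<^sub>M distr M K Y = distr M (N \<Otimes>\<^sub>M K) (\<lambda>\<omega>. (X \<omega>, Y \<omega>))"
    and A: "A \<in> sets N"
  shows "AE \<omega> in M. real_cond_exp M (vimage_algebra (space M) Y K) (indicator (X -` A \<inter> space M)) \<omega> =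
    prob (X -` A \<inter> space M)"
proof -
  interpret Y: prob_space "distr M K Y"
    by (rule prob_space_distr) simp
  interpret F: finite_measure_subalgebra M "vimage_algebra (space M) Y K"
    by (rule finite_measure_subalgebra_vimage_algebra[OF Y])
  have XA: "X -` A \<inter> space M \<in> events"
    using X A by (rule measurable_sets)
  show ?thesis
  proof (rule F.real_cond_exp_charact)
    fix C assume "C \<in> sets (vimage_algebra (space M) Y K)"
    then obtain C' where C': "C' \<in> sets K" "C = Y -` C' \<inter> space M"
      using measurable_space[OF Y] by (auto simp: sets_vimage_algebra2)
    have C: "C \<in> events"
      using C' Y by (auto intro: measurable_sets)
    have "(LINT \<omega>:C|M. indicat_real (X -` A \<inter> space M) \<omega>) = (LINT \<omega>|M. indicat_real (C \<inter> (X -` A \<inter> space M)) \<omega>)"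
      unfolding set_lebesgue_integral_def by (simp add: indicator_inter_arith)
    also have "\<dots> = prob (C \<inter> (X -` A \<inter> space M))"
      using C XA by simp
    also have "C \<inter> (X -` A \<inter> space M) = (\<lambda>x. (X x, Y x)) -` (A \<times> C') \<inter> space M"
      using C' by auto
    also have "prob \<dots> = measure (distr M N X \<Otimes>\<^sub>M distr M K Y) (A \<times> C')"
      unfolding joint using A C'(1) by (intro measure_distr[symmetric]) auto
    also have "\<dots> = prob (X -` A \<inter> space M) * prob C"
      using A C' X Y by (simp add: measure_def Y.emeasure_pair_measure_Times enn2real_mult emeasure_distr)
    also have "\<dots> = (LINT \<omega>:C|M. prob (X -` A \<inter> space M))"
      unfolding set_lebesgue_integral_def using C by simp
    finally show "(LINT \<omega>:C|M. indicat_real (X -` A \<inter> space M) \<omega>) = (LINT \<omega>:C|M. prob (X -` A \<inter> space M))" .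
  qed (use XA in \<open>auto simp: integrable_real_indicator emeasure_eq_measure\<close>)
qed

text \<open>The conditional probability of \<open>E n\<close> has expectation
  \<open>prob (E n)\<close>, so Markov's inequality turns a rate for the unconditional probabilities
  into the same rate in probability for the conditional ones.\<close>

lemma (in prob_space) small_o_prob_cond_probability:
  assumes F: "\<And>n. finite_measure_subalgebra M (F n)"
    and E: "\<And>n. E n \<in> events"
    and a: "\<And>n. 0 < a n" and lim: "(\<lambda>n. prob (E n) / a n) \<longlonglongrightarrow> 0"
  shows "small_o_prob M F a (\<lambda>n. cond_probability M (F n) (E n))"
  unfolding small_o_prob_def
proof (intro conjI allI impI)
  show "cond_probability M (F n) (E n) \<in> borel_measurable (F n)" for n
    by (simp add: cond_probability_def)
next
  fix \<epsilon> :: real assume \<epsilon>: "0 < \<epsilon>"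
  let ?R = "\<lambda>n. cond_probability M (F n) (E n)"
  have le: "prob {\<omega> \<in> space M. \<epsilon> < \<bar>?R n \<omega> / a n\<bar>} \<le> prob (E n) / a n / \<epsilon>" for n
  proof -
    interpret F: finite_measure_subalgebra M "F n" by (rule F)
    have ind: "integrable M (indicat_real (E n))"
      using E by (simp add: integrable_real_indicator emeasure_eq_measure)
    have R: "integrable M (?R n)" "(\<integral>\<omega>. ?R n \<omega> \<partial>M) = prob (E n)"
      using F.real_cond_exp_int[OF ind] E by (simp_all add: cond_probability_def)
    have [measurable]: "?R n \<in> borel_measurable M"
      using R(1) by simp
    have pos: "AE \<omega> in M. 0 \<le> ?R n \<omega>"
      unfolding cond_probability_def using ind by (intro F.real_cond_exp_pos) auto
    have "prob {\<omega> \<in> space M. \<epsilon> < \<bar>?R n \<omega> / a n\<bar>} \<le> prob {\<omega> \<in> space M. ?R n \<omega> \<ge> \<epsilon> * a n}"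
    proof (rule finite_measure_mono_AE)
      show "AE \<omega> in M. \<omega> \<in> {\<omega> \<in> space M. \<epsilon> < \<bar>?R n \<omega> / a n\<bar>} \<longrightarrow> \<omega> \<in> {\<omega> \<in> space M. ?R n \<omega> \<ge> \<epsilon> * a n}"
        using pos by eventually_elim (use a[of n] in \<open>auto simp: field_simps\<close>)
    qed measurable
    also have "\<dots> \<le> (\<integral>\<omega>. ?R n \<omega> \<partial>M) / (\<epsilon> * a n)"
      by (rule integral_Markov_inequality_measure[OF R(1) sets.top pos]) (use \<epsilon> a in simp)
    finally show ?thesis
      by (simp add: R(2) mult.commute)
  qed
  show "(\<lambda>n. prob {\<omega> \<in> space M. \<epsilon> < \<bar>?R n \<omega> / a n\<bar>}) \<longlonglongrightarrow> 0"
  proof (rule tendsto_sandwich[where f = "\<lambda>_. 0" and h = "\<lambda>n. prob (E n) / a n / \<epsilon>"])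
    show "\<forall>\<^sub>F n in sequentially. prob {\<omega> \<in> space M. \<epsilon> < \<bar>?R n \<omega> / a n\<bar>} \<le> prob (E n) / a n / \<epsilon>"
      by (intro always_eventually allI le)
    show "(\<lambda>n. prob (E n) / a n / \<epsilon>) \<longlonglongrightarrow> 0"
      using tendsto_divide[OF lim tendsto_const[of \<epsilon>]] \<epsilon> by simp
  qed simp_all
qed

theorem theorem4:
  fixes M :: "'w measure"
    and \<U> :: "'u::euclidean_space set"
    and N :: "'u measure"
    and U Ustar :: "'w \<Rightarrow> 'u"
    and V :: "nat \<Rightarrow> 'w \<Rightarrow> 'u"
    and \<Upsilon> :: "'k set"
    and \<Theta> :: "('k \<times> 'x) set"
    and G :: "'k \<Rightarrow> 'x \<Rightarrow> 'u \<Rightarrow> 'z::topological_space"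
    and L :: "'z \<Rightarrow> 'z \<Rightarrow> real"
    and T :: "'u \<Rightarrow> 'k \<times> 'x \<Rightarrow> 'q::euclidean_space"
    and B :: "real \<Rightarrow> 'k \<times> 'x \<Rightarrow> 'q set"
    and \<kappa>0 :: 'k and \<xi>0 :: 'x
    and S :: "'u \<Rightarrow> 'u set"
    and P_N :: real
    and Z :: "'w \<Rightarrow> 'z"
    and Vc :: "nat \<Rightarrow> 'w \<Rightarrow> 'u set"
  defines "N \<equiv> restrict_space borel \<U>"
    and "Z \<equiv> (\<lambda>\<omega>. G \<kappa>0 \<xi>0 (U \<omega>))"
    and "Vc \<equiv> (\<lambda>n \<omega>. (\<lambda>i. V i \<omega>) ` {..<n})"
  assumes prob: "prob_space M"
    and params: "countable \<Upsilon>" "fst ` \<Theta> = \<Upsilon>" "(\<kappa>0, \<xi>0) \<in> \<Theta>"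
    and loss_cont: "continuous_on UNIV (\<lambda>(z, z'). L z z')"
    and U_rv: "U \<in> measurable M N"
    and T_meas: "\<forall>\<theta>\<in>\<Theta>. (\<lambda>u. T u \<theta>) \<in> borel_measurable N"
    and B_borel: "\<forall>\<alpha>\<in>{0<..<1}. \<forall>\<theta>\<in>\<Theta>. B \<alpha> \<theta> \<in> sets borel"
    and B_level: "\<forall>\<alpha>\<in>{0<..<1}. \<forall>\<theta>\<in>\<Theta>. measure M {\<omega> \<in> space M. T (U \<omega>) \<theta> \<in> B \<alpha> \<theta>} \<ge> \<alpha>"
    \<comment> \<open>the neighbourhoods, within the space \<open>\<U>\<close>\<close>
    and S_nbhd: "\<forall>u\<in>\<U>. u \<in> top_of_set \<U> interior_of S u"
    and S_sub: "\<forall>u\<in>\<U>. S u \<subseteq> {u'\<in>\<U>. \<kappa>0 \<in> argmin_kappa \<Upsilon> \<Theta> L G (G \<kappa>0 \<xi>0 u) u'}"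
    and S_meas: "{(u, u'). u \<in> \<U> \<and> u' \<in> S u} \<in> sets (N \<Otimes>\<^sub>M N)"
    \<comment> \<open>\<open>U\<^sup>*\<close> is an independent copy of \<open>U\<close>; the conditional probability of \<open>U\<^sup>* \<in> S U\<close> given \<open>U\<close>
        is at least \<open>P_N\<close> almost surely (a lower bound on the unconditional probability alone does
        not give an exponential rate)\<close>
    and Ustar: "prob_space.indep_var M N U N Ustar" "distr M N Ustar = distr M N U"
    and P_N: "P_N > 0" "AE u in distr M N U. measure M {\<omega> \<in> space M. Ustar \<omega> \<in> S u} \<ge> P_N"
    \<comment> \<open>the Monte-Carlo copies \<open>V 0, V 1, \<dots>\<close> of \<open>U\<close> are independent of each other and of \<open>U\<close>;
        \<open>Vc n\<close> collects the first \<open>n\<close> of them\<close>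
    and V_copies: "\<forall>i. distr M N (V i) = distr M N U"
    and V_indep: "prob_space.indep_vars M (\<lambda>_. N) (\<lambda>k. case k of 0 \<Rightarrow> U | Suc i \<Rightarrow> V i) UNIV"
    \<comment> \<open>the events in the conclusion have well-defined probabilities\<close>
    and event_a: "\<forall>n. {\<omega> \<in> space M. \<kappa>0 \<in> candidate_set \<Upsilon> \<Theta> L G (Vc n \<omega>) (Z \<omega>)} \<in> sets M"
    and event_b: "\<forall>\<alpha>\<in>{0<..<1}. \<forall>n.
      {\<omega> \<in> space M. (\<kappa>0, \<xi>0) \<in> conf_set \<Upsilon> \<Theta> L G \<U> T (B \<alpha>) (Vc n \<omega>) (Z \<omega>)} \<in> sets M"
  shows "\<exists>c>0.
    (\<exists>R. small_o_prob M (mc_sigma M N V) (\<lambda>n. exp (- c * real n)) R \<and>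
      (\<forall>n. AE \<omega> in M.
        cond_probability M (mc_sigma M N V n)
          {\<omega> \<in> space M. \<kappa>0 \<in> candidate_set \<Upsilon> \<Theta> L G (Vc n \<omega>) (Z \<omega>)} \<omega> = 1 - R n \<omega>)) \<and>
    (\<forall>\<alpha>\<in>{0<..<1}.
      \<exists>R. small_o_prob M (mc_sigma M N V) (\<lambda>n. exp (- c * real n)) R \<and>
      (\<forall>n. AE \<omega> in M.
        cond_probability M (mc_sigma M N V n)
          {\<omega> \<in> space M. (\<kappa>0, \<xi>0) \<in> conf_set \<Upsilon> \<Theta> L G \<U> T (B \<alpha>) (Vc n \<omega>) (Z \<omega>)} \<omega>
            \<ge> \<alpha> - R n \<omega>))"
proof -
  interpret prob_space M by (rule prob)
  let ?D = "\<lambda>n. {\<omega> \<in> space M. \<kappa>0 \<in> candidate_set \<Upsilon> \<Theta> L G (Vc n \<omega>) (Z \<omega>)}"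
  let ?E = "\<lambda>n. space M - ?D n"
  let ?F = "mc_sigma M N V"
  let ?W = "{(u, u'). u \<in> \<U> \<and> u' \<in> S u}"
  let ?W' = "space (N \<Otimes>\<^sub>M N) - ?W"
  let ?R = "\<lambda>n. cond_probability M (?F n) (?E n)"
  have N: "space N = \<U>"
    by (simp add: N_def space_restrict_space)
  have UU: "U \<omega> \<in> \<U>" if "\<omega> \<in> space M" for \<omega>
    using measurable_space[OF U_rv that] N by simp
  have V: "indep_vars (\<lambda>_. N) V UNIV"
    by (rule indep_vars_tail[OF V_indep])
  then have V_rv: "V i \<in> measurable M N" for i
    by (simp add: indep_vars_def)
  have V_vec: "(\<lambda>\<omega>. \<lambda>i\<in>{..<n}. V i \<omega>) \<in> measurable M (PiM {..<n} (\<lambda>_. N))" for n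
    using V_rv by (intro measurable_restrict)
  have Ustar_rv: "Ustar \<in> measurable M N"
    using Ustar(1) by (auto simp: indep_var_distribution_eq)
  have F: "finite_measure_subalgebra M (?F n)" for n
    unfolding mc_sigma_def
    by (rule finite_measure_subalgebra_vimage_algebra[OF V_vec])
  have E: "?E n \<in> events" for n
    using event_a by auto
  have miss: "prob {\<omega> \<in> space M. (u, V i \<omega>) \<in> ?W'} \<le> exp (- P_N)"
    if u: "u \<in> \<U>" and le: "P_N \<le> measure M {\<omega> \<in> space M. Ustar \<omega> \<in> S u}" for u i
  proof -
    have Su: "S u \<in> sets N"
      using sets_Pair1[OF S_meas, of u] u by (simp add: vimage_def)
    have "{\<omega> \<in> space M. (u, V i \<omega>) \<in> ?W'} = space M - (V i -` S u \<inter> space M)"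
      using u measurable_space[OF V_rv[of i]] N by (auto simp: space_pair_measure)
    then have "prob {\<omega> \<in> space M. (u, V i \<omega>) \<in> ?W'} = 1 - prob (V i -` S u \<inter> space M)"
      using prob_compl[of "V i -` S u \<inter> space M"] measurable_sets[OF V_rv Su] by simp
    also have "prob (V i -` S u \<inter> space M) = measure (distr M N (V i)) (S u)"
      by (rule measure_distr[OF V_rv Su, symmetric])
    also have "\<dots> = measure (distr M N Ustar) (S u)"
      using V_copies Ustar(2) by simp
    also have "\<dots> = prob (Ustar -` S u \<inter> space M)"
      by (rule measure_distr[OF Ustar_rv Su])
    also have "Ustar -` S u \<inter> space M = {\<omega> \<in> space M. Ustar \<omega> \<in> S u}"
      by auto
    finally show ?thesis
      using le exp_ge_add_one_self[of "- P_N"] by simp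
  qed
  have E_le: "prob (?E n) \<le> exp (- P_N) ^ n" for n
  proof -
    have W': "?W' \<in> sets (N \<Otimes>\<^sub>M N)"
      using S_meas by auto
    have all_miss: "{\<omega> \<in> space M. \<forall>i\<in>{..<n}. (U \<omega>, V i \<omega>) \<in> ?W'} \<in> events"
      using U_rv V_rv W' by measurable
    have "?E n \<subseteq> {\<omega> \<in> space M. \<forall>i\<in>{..<n}. (U \<omega>, V i \<omega>) \<in> ?W'}"
      using S_sub UU measurable_space[OF V_rv] N
      by (fastforce simp: Vc_def Z_def candidate_set_def space_pair_measure)
    then have "prob (?E n) \<le> prob {\<omega> \<in> space M. \<forall>i\<in>{..<n}. (U \<omega>, V i \<omega>) \<in> ?W'}"
      using all_miss by (rule finite_measure_mono)
    also have "\<dots> \<le> exp (- P_N) ^ card {..<n}"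
    proof (rule prob_indep_all_le_power[OF _ U_rv _ distr_head_tail_eq[OF V_indep] W'])
      show "indep_vars (\<lambda>_. N) V {..<n}"
        using V by (rule indep_vars_subset) simp
      show "AE u in distr M N U. \<forall>i\<in>{..<n}. prob {\<omega> \<in> space M. (u, V i \<omega>) \<in> ?W'} \<le> exp (- P_N)"
        using P_N(2) AE_space by eventually_elim (use miss N in auto)
    qed simp_all
    finally show ?thesis by simp
  qed
  define c where "c = P_N / 2"
  have c: "0 < c"
    using P_N(1) by (simp add: c_def)
  have ratio: "prob (?E n) / exp (- c * real n) \<le> exp (- c) ^ n" for n
  proof -
    have "exp (- P_N) ^ n = exp (- c) ^ n * exp (- c * real n)"
      by (simp add: c_def field_simps flip: exp_of_nat_mult exp_add)
    then show ?thesis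
      using E_le[of n] by (subst pos_divide_le_eq) simp_all
  qed
  have "(\<lambda>n. prob (?E n) / exp (- c * real n)) \<longlonglongrightarrow> 0"
  proof (rule tendsto_sandwich[where f = "\<lambda>_. 0" and h = "\<lambda>n. exp (- c) ^ n"])
    show "\<forall>\<^sub>F n in sequentially. prob (?E n) / exp (- c * real n) \<le> exp (- c) ^ n"
      by (intro always_eventually allI ratio)
    show "(\<lambda>n. exp (- c) ^ n) \<longlonglongrightarrow> 0"
      using c by (intro LIMSEQ_realpow_zero) auto
    show "\<forall>\<^sub>F n in sequentially. 0 \<le> prob (?E n) / exp (- c * real n)"
      by simp
  qed simp
  then have small: "small_o_prob M ?F (\<lambda>n. exp (- c * real n)) ?R"
    by (intro small_o_prob_cond_probability F E) simp_all
  have ind: "integrable M (indicat_real A)" if "A \<in> events" for A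
    using that by (simp add: integrable_real_indicator emeasure_eq_measure)
  have a: "AE \<omega> in M. cond_probability M (?F n) (?D n) \<omega> = 1 - ?R n \<omega>" for n
  proof -
    interpret F: finite_measure_subalgebra M "?F n" by (rule F)
    have D: "?D n \<in> events"
      using event_a by simp
    have "AE \<omega> in M. real_cond_exp M (?F n) (\<lambda>\<omega>. indicator (?D n) \<omega> + indicator (?E n) \<omega>) \<omega> =
        real_cond_exp M (?F n) (indicator (?D n)) \<omega> + real_cond_exp M (?F n) (indicator (?E n)) \<omega>"
      by (rule F.real_cond_exp_add[OF ind[OF D] ind[OF E]])
    moreover have "AE \<omega> in M. real_cond_exp M (?F n) (\<lambda>\<omega>. indicator (?D n) \<omega> + indicator (?E n) \<omega>) \<omega> =
        real_cond_exp M (?F n) (\<lambda>_. 1) \<omega>"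
      by (rule F.real_cond_exp_cong) (use D E in \<open>auto simp: indicator_def intro!: AE_I2\<close>)
    moreover have "AE \<omega> in M. real_cond_exp M (?F n) (\<lambda>_. 1) \<omega> = 1"
      by (rule F.real_cond_exp_F_meas) auto
    ultimately show ?thesis
      unfolding cond_probability_def by eventually_elim simp
  qed
  have b: "AE \<omega> in M. cond_probability M (?F n)
      {\<omega> \<in> space M. (\<kappa>0, \<xi>0) \<in> conf_set \<Upsilon> \<Theta> L G \<U> T (B \<alpha>) (Vc n \<omega>) (Z \<omega>)} \<omega> \<ge> \<alpha> - ?R n \<omega>"
    (is "AE \<omega> in M. cond_probability M _ ?C \<omega> \<ge> _") if \<alpha>: "\<alpha> \<in> {0<..<1}" for \<alpha> n
  proof -
    interpret F: finite_measure_subalgebra M "?F n" by (rule F)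
    let ?A = "(\<lambda>u. T u (\<kappa>0, \<xi>0)) -` B \<alpha> (\<kappa>0, \<xi>0) \<inter> space N"
    let ?H = "U -` ?A \<inter> space M"
    have A: "?A \<in> sets N"
      using T_meas B_borel params(3) \<alpha> by (blast intro: measurable_sets)
    have H: "?H \<in> events"
      using U_rv A by (rule measurable_sets)
    have C: "?C \<in> events"
      using event_b \<alpha> by blast
    have "?H = {\<omega> \<in> space M. T (U \<omega>) (\<kappa>0, \<xi>0) \<in> B \<alpha> (\<kappa>0, \<xi>0)}"
      using UU N by auto
    then have level: "\<alpha> \<le> prob ?H"
      using B_level params(3) \<alpha> by simp
    have "?H - ?E n \<subseteq> ?C"
      using UU params(3) by (auto simp: conf_set_def Z_def)
    then have "AE \<omega> in M. indicat_real ?H \<omega> - indicat_real (?E n) \<omega> \<le> indicat_real ?C \<omega>"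
      by (intro AE_I2) (auto split: split_indicator)
    then have "AE \<omega> in M. real_cond_exp M (?F n) (\<lambda>\<omega>. indicator ?H \<omega> - indicator (?E n) \<omega>) \<omega> \<le>
        real_cond_exp M (?F n) (indicator ?C) \<omega>"
      by (rule F.real_cond_exp_mono) (intro Bochner_Integration.integrable_diff ind H E C)+
    moreover have "AE \<omega> in M. real_cond_exp M (?F n) (\<lambda>\<omega>. indicator ?H \<omega> - indicator (?E n) \<omega>) \<omega> =
        real_cond_exp M (?F n) (indicator ?H) \<omega> - real_cond_exp M (?F n) (indicator (?E n)) \<omega>"
      by (rule F.real_cond_exp_diff[OF ind[OF H] ind[OF E]])
    moreover have "AE \<omega> in M. real_cond_exp M (?F n) (indicator ?H) \<omega> = prob ?H"
      unfolding mc_sigma_def by (rule real_cond_exp_indep_event[OF U_rv V_vec distr_head_tail_eq[OF V_indep] A])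
    ultimately show ?thesis
      unfolding cond_probability_def by eventually_elim (use level in linarith)
  qed
  show ?thesis
    using c small a b by blast
qed

end
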